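(* Let $\tau>0$, let $\{A(t)\}_{t\in\mathbb{R}}$ satisfy the Acquistapace–Terreni conditions on $\mathbb{R}$ with associated evolution family $U(t,s)$, suppose $(t,s)\mapsto U(t,s)x$ is Bi-almost automorphic uniformly for $x$ in bounded subsets of $\mathbb{X}$, and suppose $\|U(t,s)\|\le Me^{-\delta(t-s)}$ for $t\ge s$ with constants $M,\delta>0$. Let $f\in AA(\mathbb{R}\times\mathbb{X};\mathbb{X})$ be $L_f$-Lipschitz (in the second variable, uniformly in the first). Let $\rho>0$ be such that $$\frac{M}{\delta}\|f(\cdot,0)\|_\infty\le\rho\qquad\text{and}\qquad ML_f<\frac{\rho\delta}{\rho+\|x_0\|_\infty},$$ where $x_0(t)=\int_{-\infty}^tU(t,s)f(s,0)\,ds$. Then there is a unique mild solution $x\in AA(\mathbb{R};\mathbb{X})$ of $$x'(t)=A(t)x(t)+f(t,x(t-\tau)),\quad t\in\mathbb{R},$$ such that $\|x-x_0\|_\infty\le\rho$.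
   Context: $\mathbb{X}$ is a Banach space; $\|\cdot\|_\infty$ is the supremum norm. $AA(\mathbb{R};\mathbb{X})$ (almost automorphic functions): bounded continuous $f:\mathbb{R}\to\mathbb{X}$ such that every real sequence has a subsequence $(s_n)$ and a function $\tilde f$ with $\lim_nf(t+s_n)=\tilde f(t)$, $\lim_n\tilde f(t-s_n)=f(t)$ for each $t$. $AA(\mathbb{R}\times\mathbb{X};\mathbb{X})$: bounded continuous $f:\mathbb{R}\times\mathbb{X}\to\mathbb{X}$ such that for every bounded $\mathcal{D}\subset\mathbb{X}$ and every real sequence there are a subsequence $(s_n)$ and $\tilde f$ with $\lim_nf(t+s_n,x)=\tilde f(t,x)$, $\lim_n\tilde f(t-s_n,x)=f(t,x)$, pointwise in $t$, uniformly for $x\in\mathcal{D}$. Acquistapace–Terreni conditions on $\mathbb{R}$: $A(t):D(A(t))\subset\mathbb{X}\to\mathbb{X}$ are linear and there are constants $\lambda_0\ge0$, $\theta\in(\pi/2,\pi)$, $K_1,K_2\ge0$, $\beta_1,\beta_2\in(0,1]$ with $\beta_1+\beta_2>1$ such that for $t,s\in\mathbb{R}$ and $\lambda\in\Sigma_\theta=\{\lambda\in\mathbb{C}\setminus\{0\}:|\arg\lambda|\le\theta\}$: $\Sigma_\theta\cup\{0\}\subset\rho(A(t)-\lambda_0)$, $\|R(\lambda,A(t)-\lambda_0)\|\le\frac{K_1}{1+|\lambda|}$, and $\|(A(t)-\lambda_0)R(\lambda,A(t)-\lambda_0)[R(\lambda_0,A(t))-R(\lambda_0,A(s))]\|\le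 K_2|t-s|^{\beta_1}|\lambda|^{-\beta_2}$. Under these there is a unique evolution family $U(t,s)$, $t\ge s$ in $\mathbb{R}$, governing $x'(t)=A(t)x(t)$: bounded operators with $U(t,t)=I$, $U(t,s)U(s,r)=U(t,r)$ for $t\ge s\ge r$, strongly continuous in $(t,s)$. $(t,s)\mapsto U(t,s)x$ Bi-almost automorphic uniformly on bounded sets: it is jointly continuous and for every real sequence and every bounded $\mathcal{D}\subset\mathbb{X}$ there is a subsequence $(s_n)$ with $\tilde U(t,s)x:=\lim_nU(t+s_n,s+s_n)x$ existing and $\lim_n\tilde U(t-s_n,s-s_n)x=U(t,s)x$ for each $t\ge s$, uniformly for $x\in\mathcal{D}$. Mild solution: a continuous $x:\mathbb{R}\to\mathbb{X}$ with $x(t)=U(t,a)x(a)+\int_a^tU(t,s)f(s,x(s-\tau))\,ds$ for all $t\ge a$ in $\mathbb{R}$. *)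

theory Defs
  imports "HOL-Analysis.Analysis"
begin

(* The resolvent conditions involve complex spectral parameters, so the underlying space
   has to be a complex Banach space; HOL-Analysis only provides real scalars. *)

class complex_banach = banach +
  fixes scaleC :: "complex \<Rightarrow> 'a \<Rightarrow> 'a" (infixr "*\<^sub>C" 75)
  assumes scaleC_add_right: "c *\<^sub>C (x + y) = c *\<^sub>C x + c *\<^sub>C y"
    and scaleC_add_left: "(c + d) *\<^sub>C x = c *\<^sub>C x + d *\<^sub>C x"
    and scaleC_scaleC: "c *\<^sub>C (d *\<^sub>C x) = (c * d) *\<^sub>C x"
    and scaleC_of_real: "complex_of_real r *\<^sub>C x = r *\<^sub>R x"
    and norm_scaleC: "norm (c *\<^sub>C x) = cmod c * norm x"

instantiation complex :: complex_banach
begin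

definition scaleC_complex :: "complex \<Rightarrow> complex \<Rightarrow> complex"
  where "scaleC_complex c x = c * x"

instance
  by standard (simp_all add: scaleC_complex_def algebra_simps norm_mult scaleR_conv_of_real)

end

(* Only meaningful for bounded g: the supremum of a set of reals that is not bounded above
   is unspecified. *)
definition sup_norm :: "('t \<Rightarrow> 'a::real_normed_vector) \<Rightarrow> real"
  where "sup_norm g = (SUP t. norm (g t))"


definition almost_automorphic :: "(real \<Rightarrow> 'a::real_normed_vector) \<Rightarrow> bool"
  where "almost_automorphic f \<longleftrightarrow>
    continuous_on UNIV f \<and> bounded (range f) \<and>
    (\<forall>\<sigma> :: nat \<Rightarrow> real. \<exists>r ft. strict_mono r \<and>
      (\<forall>t. (\<lambda>n. f (t + \<sigma> (r n))) \<longlonglongrightarrow> ft t \<and>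
           (\<lambda>n. ft (t - \<sigma> (r n))) \<longlonglongrightarrow> f t))"

definition almost_automorphic2 ::
    "(real \<Rightarrow> 'a::real_normed_vector \<Rightarrow> 'b::real_normed_vector) \<Rightarrow> bool"
  where "almost_automorphic2 f \<longleftrightarrow>
    continuous_on UNIV (\<lambda>(t, x). f t x) \<and> bounded (range (\<lambda>(t, x). f t x)) \<and>
    (\<forall>B. bounded B \<longrightarrow> (\<forall>\<sigma> :: nat \<Rightarrow> real. \<exists>r ft. strict_mono r \<and>
      (\<forall>t. uniform_limit B (\<lambda>n x. f (t + \<sigma> (r n)) x) (ft t) sequentially \<and>
           uniform_limit B (\<lambda>n x. ft (t - \<sigma> (r n)) x) (f t) sequentially)))"

definition bi_almost_automorphic ::
    "(real \<Rightarrow> real \<Rightarrow> 'a::real_normed_vector \<Rightarrow> 'b::real_normed_vector) \<Rightarrow> bool"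
  where "bi_almost_automorphic U \<longleftrightarrow>
    (\<forall>x. continuous_on {(t, s). s \<le> t} (\<lambda>(t, s). U t s x)) \<and>
    (\<forall>\<sigma> :: nat \<Rightarrow> real. \<forall>B. bounded B \<longrightarrow> (\<exists>r Ut. strict_mono r \<and>
      (\<forall>t s. s \<le> t \<longrightarrow>
        uniform_limit B (\<lambda>n x. U (t + \<sigma> (r n)) (s + \<sigma> (r n)) x) (Ut t s) sequentially \<and>
        uniform_limit B (\<lambda>n x. Ut (t - \<sigma> (r n)) (s - \<sigma> (r n)) x) (U t s) sequentially)))"


(* An unbounded operator is given by its domain D together with a function that is only
   relevant on D. *)

definition linear_operator_on :: "'a::complex_banach set \<Rightarrow> ('a \<Rightarrow> 'a) \<Rightarrow> bool"
  where "linear_operator_on D A \<longleftrightarrow>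
    0 \<in> D \<and>
    (\<forall>x\<in>D. \<forall>y\<in>D. x + y \<in> D \<and> A (x + y) = A x + A y) \<and>
    (\<forall>c. \<forall>x\<in>D. c *\<^sub>C x \<in> D \<and> A (c *\<^sub>C x) = c *\<^sub>C A x)"

definition resolvent :: "'a::complex_banach set \<Rightarrow> ('a \<Rightarrow> 'a) \<Rightarrow> complex \<Rightarrow> 'a \<Rightarrow> 'a"
  where "resolvent D A l = inv_into D (\<lambda>x. l *\<^sub>C x - A x)"

definition resolvent_set :: "'a::complex_banach set \<Rightarrow> ('a \<Rightarrow> 'a) \<Rightarrow> complex set"
  where "resolvent_set D A =
    {l. bij_betw (\<lambda>x. l *\<^sub>C x - A x) D UNIV \<and> bounded_linear (resolvent D A l)}"

definition sector :: "real \<Rightarrow> complex set"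
  where "sector \<theta> = {l. l \<noteq> 0 \<and> \<bar>Arg l\<bar> \<le> \<theta>}"

definition acquistapace_terreni ::
    "(real \<Rightarrow> 'a::complex_banach set) \<Rightarrow> (real \<Rightarrow> 'a \<Rightarrow> 'a) \<Rightarrow> bool"
  where "acquistapace_terreni D A \<longleftrightarrow>
    (\<forall>t. linear_operator_on (D t) (A t)) \<and>
    (\<exists>l0 \<theta> K1 K2 \<beta>1 \<beta>2 :: real.
      0 \<le> l0 \<and> pi / 2 < \<theta> \<and> \<theta> < pi \<and> 0 \<le> K1 \<and> 0 \<le> K2 \<and>
      0 < \<beta>1 \<and> \<beta>1 \<le> 1 \<and> 0 < \<beta>2 \<and> \<beta>2 \<le> 1 \<and> 1 < \<beta>1 + \<beta>2 \<and>
      (let A0 = (\<lambda>t x. A t x - l0 *\<^sub>R x) in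
        (\<forall>t. sector \<theta> \<union> {0} \<subseteq> resolvent_set (D t) (A0 t)) \<and>
        (\<forall>t. \<forall>l\<in>sector \<theta>. onorm (resolvent (D t) (A0 t) l) \<le> K1 / (1 + cmod l)) \<and>
        (\<forall>t s. \<forall>l\<in>sector \<theta>.
          onorm (\<lambda>x. A0 t (resolvent (D t) (A0 t) l
                   (resolvent (D t) (A t) (of_real l0) x - resolvent (D s) (A s) (of_real l0) x)))
            \<le> K2 * \<bar>t - s\<bar> powr \<beta>1 * cmod l powr (- \<beta>2))))"


(* The values U t s with t < s are irrelevant.  The operators U t s are real-linear by their
   type, so complex homogeneity is required separately. *)
definition evolution_family :: "(real \<Rightarrow> real \<Rightarrow> 'a::complex_banach \<Rightarrow>\<^sub>L 'a) \<Rightarrow> bool"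
  where "evolution_family U \<longleftrightarrow>
    (\<forall>t s c x. s \<le> t \<longrightarrow> U t s (c *\<^sub>C x) = c *\<^sub>C U t s x) \<and>
    (\<forall>t. U t t = id_blinfun) \<and>
    (\<forall>t s r. r \<le> s \<longrightarrow> s \<le> t \<longrightarrow> U t s o\<^sub>L U s r = U t r) \<and>
    (\<forall>x. continuous_on {(t, s). s \<le> t} (\<lambda>(t, s). U t s x))"

(* U governs x'(t) = A(t) x(t): every orbit of U is a classical solution, i.e. it is
   continuously differentiable after the initial time, takes its values there in the domains
   D t, and satisfies the equation.  (Continuity up to the initial time is part of
   evolution_family.)  Under the Acquistapace-Terreni conditions these requirements determine
   U t s for s <= t. *)
definition governs ::
    "(real \<Rightarrow> 'a::complex_banach set) \<Rightarrow> (real \<Rightarrow> 'a \<Rightarrow> 'a) \<Rightarrow> (real \<Rightarrow> real \<Rightarrow> 'a \<Rightarrow>\<^sub>L 'a) \<Rightarrow> bool"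
  where "governs D A U \<longleftrightarrow>
    (\<forall>s x.
      (\<forall>t>s. U t s x \<in> D t \<and>
        ((\<lambda>t. U t s x) has_vector_derivative A t (U t s x)) (at t)) \<and>
      continuous_on {s<..} (\<lambda>t. A t (U t s x)))"

(* Mild solutions of x'(t) = A(t) x(t) + f(t, x(t - tau)), where U governs the linear part.
   The Henstock-Kurzweil integral is used because the library's Bochner integral is confined
   to second countable spaces; the integrand is continuous on {a..t}. *)
definition mild_solution ::
    "(real \<Rightarrow> real \<Rightarrow> 'a::complex_banach \<Rightarrow>\<^sub>L 'a) \<Rightarrow> (real \<Rightarrow> 'a \<Rightarrow> 'a) \<Rightarrow> real \<Rightarrow> (real \<Rightarrow> 'a) \<Rightarrow> bool"
  where "mild_solution U f \<tau> x \<longleftrightarrow>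
    continuous_on UNIV x \<and>
    (\<forall>a t. a \<le> t \<longrightarrow>
      x t = U t a (x a) + integral {a..t} (\<lambda>s. U t s (f s (x (s - \<tau>)))))"

end

(* On bounded continuous functions consider the operator taking x to the function
   t |-> integral over s <= t of U t s (f s (x (s - tau))).  Exponential stability makes it a
   contraction with constant M L / delta, and the smallness condition makes it map the rho-ball
   around x0 into itself.  It preserves almost automorphy, and almost automorphic functions are
   closed under uniform limits (a diagonal argument), so Banach's theorem gives a unique almost
   automorphic fixed point in the ball.  Fixed points are exactly the bounded mild solutions. *)

theory Submission
  imports Defs "HOL-Library.Diagonal_Subsequence"
begin

subsection \<open>Improper integrals of dominated continuous functions\<close>

text \<open>The delicate point is that the integral operator preserves almost automorphy. With
  \<open>r = t - s\<close> it becomes an integral over the fixed half-line \<open>{0..}\<close> with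
  majorant \<open>M * C * exp (- \<delta> * r)\<close> independent of \<open>t\<close>. A
  translation of time then changes only the integrand and moves both time arguments of
  \<open>U\<close> by the same amount, which is what bi-almost automorphy controls. No continuity or
  Lipschitz bound is assumed of the limit functions, so the return limits rest on uniform
  convergence over a bounded set containing all values that occur. The smallness condition works
  because \<open>x0\<close> is the image of the zero function. With
  \<open>q = M * L / \<delta>\<close> and \<open>c = sup_norm x0\<close>, a function in the ball has
  norm at most \<open>\<rho> + c\<close>, so its image lies within \<open>q * (\<rho> + c)\<close>
  of \<open>x0\<close>. The same inequality forces \<open>q < 1\<close>: one hypothesis yields both
  the self-map and the contraction.\<close>

lemma integrable_on_dominated:
  fixes f :: "'n::euclidean_space \<Rightarrow> 'b::banach"
  assumes loc: "\<And>a b. (\<lambda>x. if x \<in> S then f x else 0) integrable_on cbox a b"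
    and g: "g integrable_on S" and le: "\<And>x. x \<in> S \<Longrightarrow> norm (f x) \<le> g x"
  shows "f integrable_on S"
proof (rule integrable_alt[THEN iffD2], intro conjI allI impI)
  let ?f = "\<lambda>x. if x \<in> S then f x else 0" and ?g = "\<lambda>x. if x \<in> S then g x else 0"
  show "?f integrable_on cbox a b" for a b by (rule loc)
  have gloc: "?g integrable_on cbox a b" for a b
    using iffD1[OF integrable_alt g] by blast
  have fg: "norm (?f x) \<le> ?g x" for x using le by auto
  \<comment> \<open>Between nested boxes \<open>f\<close> is dominated by \<open>g\<close>, so
    increments of its integrals are controlled by those of \<open>g\<close>; this transfers the
    Cauchy criterion from \<open>g\<close> to \<open>f\<close>.\<close>
  have sub: "norm (integral (cbox c d) ?f - integral (cbox a b) ?f)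
      \<le> integral (cbox c d) ?g - integral (cbox a b) ?g"
    if "cbox a b \<subseteq> cbox c d" for a b c d
  proof -
    have F: "((\<lambda>x. (if x \<in> cbox c d then ?f x else 0) - (if x \<in> cbox a b then ?f x else 0))
        has_integral (integral (cbox c d) ?f - integral (cbox a b) ?f)) UNIV"
      by (intro has_integral_diff) (simp_all only: has_integral_restrict_UNIV integrable_integral[OF loc])
    have G: "((\<lambda>x. (if x \<in> cbox c d then ?g x else 0) - (if x \<in> cbox a b then ?g x else 0))
        has_integral (integral (cbox c d) ?g - integral (cbox a b) ?g)) UNIV"
      by (intro has_integral_diff) (simp_all only: has_integral_restrict_UNIV integrable_integral[OF gloc])
    have "norm ((if x \<in> cbox c d then ?f x else 0) - (if x \<in> cbox a b then ?f x else 0))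
        \<le> (if x \<in> cbox c d then ?g x else 0) - (if x \<in> cbox a b then ?g x else 0)" for x
      using fg[of x] subsetD[OF that, of x]
      by (cases "x \<in> cbox a b"; cases "x \<in> cbox c d") (simp_all del: mem_box)
    from integral_norm_bound_integral[OF has_integral_integrable[OF F] has_integral_integrable[OF G] this]
    show ?thesis
      by (simp only: integral_unique[OF F] integral_unique[OF G])
  qed
  fix e :: real assume "e > 0"
  then have "e / 2 > 0" by simp
  with spec[OF iffD1[OF integrable_alt g, THEN conjunct2], of "e / 2"] obtain B where "B > 0"
    and B: "\<forall>a b c d. ball 0 B \<subseteq> cbox a b \<and> ball 0 B \<subseteq> cbox c d \<longrightarrow>
      norm (integral (cbox a b) ?g - integral (cbox c d) ?g) < e / 2"
    by blast
  show "\<exists>B>0. \<forall>a b c d. ball 0 B \<subseteq> cbox a b \<and> ball 0 B \<subseteq> cbox c d \<longrightarrow>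
      norm (integral (cbox a b) ?f - integral (cbox c d) ?f) < e"
  proof (intro exI[of _ B] conjI \<open>B > 0\<close> allI impI, elim conjE)
    fix a b c d :: 'n
    assume ab: "ball 0 B \<subseteq> cbox a b" and cd: "ball 0 B \<subseteq> cbox c d"
    \<comment> \<open>The two boxes need not be nested, so each is compared, at cost
      \<open>e / 2\<close>, with one box containing both.\<close>
    have "bounded (cbox a b \<union> cbox c d)" by (intro bounded_Un[THEN iffD2] conjI bounded_cbox)
    then obtain u where "cbox a b \<union> cbox c d \<subseteq> cbox (- u) u"
      by (rule bounded_subset_cbox_symmetric)
    then obtain v where uv: "cbox a b \<subseteq> cbox v u" "cbox c d \<subseteq> cbox v u"
      by blast
    have "norm (integral (cbox v u) ?f - integral (cbox a b) ?f) < e / 2"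
      using sub[OF uv(1)] B[rule_format, OF conjI, OF subset_trans[OF ab uv(1)] ab] unfolding real_norm_def by linarith
    moreover have "norm (integral (cbox v u) ?f - integral (cbox c d) ?f) < e / 2"
      using sub[OF uv(2)] B[rule_format, OF conjI, OF subset_trans[OF cd uv(2)] cd] unfolding real_norm_def by linarith
    ultimately show "norm (integral (cbox a b) ?f - integral (cbox c d) ?f) < e"
      using norm_triangle_ineq4[of "integral (cbox v u) ?f - integral (cbox c d) ?f"
          "integral (cbox v u) ?f - integral (cbox a b) ?f"] by simp
  qed
qed

lemma integrable_on_atLeast_dominated:
  fixes w :: "real \<Rightarrow> 'b::banach"
  assumes "continuous_on {c..} w" "h integrable_on {c..}" "\<And>r. c \<le> r \<Longrightarrow> norm (w r) \<le> h r"
  shows "w integrable_on {c..}"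
proof (rule integrable_on_dominated)
  fix a b :: real
  have "w integrable_on ({c..} \<inter> {a..b})"
    by (simp add: Int_atLeastAtMost integrable_continuous_real
        continuous_on_subset[OF assms(1)] Icc_subset_Ici_iff Int_atLeastAtMostR2)
  then show "(\<lambda>x. if x \<in> {c..} then w x else 0) integrable_on cbox a b"
    by (simp only: integrable_restrict_Int cbox_interval)
qed (use assms in auto)

section \<open>Reflecting a half-line with moving endpoint onto a fixed one\<close>

lemma has_integral_reflect_shift:
  fixes h :: "real \<Rightarrow> 'b::banach"
  assumes "(h has_integral i) S"
  shows "((\<lambda>r. h (t - r)) has_integral i) {r. t - r \<in> S}"
proof (rule has_integral'[THEN iffD2], intro allI impI)
  fix e :: real assume "e > 0"
  with spec[OF iffD1[OF has_integral' assms], of e] obtain B where B: "B > 0"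
    "\<forall>a b. ball 0 B \<subseteq> cbox a b \<longrightarrow>
      (\<exists>z. ((\<lambda>x. if x \<in> S then h x else 0) has_integral z) (cbox a b) \<and> norm (z - i) < e)"
    by blast
  \<comment> \<open>The reflection sends the origin to \<open>t\<close>, so the radius grows by
    \<open>\<bar>t\<bar>\<close> to make the reflected box contain \<open>ball 0 B\<close>.\<close>
  have "\<exists>z. ((\<lambda>r. if r \<in> {r. t - r \<in> S} then h (t - r) else 0) has_integral z) (cbox a b) \<and> norm (z - i) < e"
    if ab: "ball 0 (B + \<bar>t\<bar>) \<subseteq> cbox a b" for a b
  proof -
    have "ball 0 B \<subseteq> cbox (t - b) (t - a)"
    proof
      fix x :: real assume "x \<in> ball 0 B"
      then have "t - x \<in> ball 0 (B + \<bar>t\<bar>)" by (auto simp: dist_norm)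
      with ab show "x \<in> cbox (t - b) (t - a)" by auto
    qed
    from B(2)[rule_format, OF this] obtain z
      where z: "((\<lambda>x. if x \<in> S then h x else 0) has_integral z) (cbox (t - b) (t - a))" "norm (z - i) < e"
      by blast
    have "(\<lambda>x. (1 / - 1) *\<^sub>R x + - ((1 / - 1) *\<^sub>R t)) ` cbox (t - b) (t - a) = cbox a b"
      by (force simp: image_iff intro: bexI[where x = "t - _"])
    with has_integral_affinity[OF z(1), of "-1" t]
    have "((\<lambda>x. if -1 *\<^sub>R x + t \<in> S then h (-1 *\<^sub>R x + t) else 0) has_integral z) (cbox a b)"
      by simp
    then have "((\<lambda>x. if t - x \<in> S then h (t - x) else 0) has_integral z) (cbox a b)"
      by (simp only: scaleR_minus1_left minus_real_def add.commute[of _ t])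
    with z(2) show ?thesis by auto
  qed
  then show "\<exists>B>0. \<forall>a b. ball 0 B \<subseteq> cbox a b \<longrightarrow>
     (\<exists>z. ((\<lambda>r. if r \<in> {r. t - r \<in> S} then h (t - r) else 0) has_integral z) (cbox a b) \<and> norm (z - i) < e)"
    using B(1) by (intro exI[of _ "B + \<bar>t\<bar>"]) auto
qed

text \<open>Integrating over the elapsed time \<open>r = t - s\<close> removes \<open>t\<close> from
  the domain, so limits and continuity in \<open>t\<close> concern integrands on one fixed set. The
  reflection is its own inverse, hence an equivalence.\<close>

lemma has_integral_atMost_iff:
  fixes h :: "real \<Rightarrow> 'b::banach"
  shows "(h has_integral i) {..t} \<longleftrightarrow> ((\<lambda>r. h (t - r)) has_integral i) {0..}"
proof
  have *: "{r. t - r \<in> {..t}} = {0..}" "{r. t - r \<in> {0..}} = {..t}" by auto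
  show "(h has_integral i) {..t} \<Longrightarrow> ((\<lambda>r. h (t - r)) has_integral i) {0..}"
    using has_integral_reflect_shift[of h i "{..t}" t] by (simp add: * del: atMost_iff)
  show "((\<lambda>r. h (t - r)) has_integral i) {0..} \<Longrightarrow> (h has_integral i) {..t}"
    using has_integral_reflect_shift[of "\<lambda>r. h (t - r)" i "{0..}" t] by (simp add: * del: atLeast_iff)
qed

lemma integrable_on_atMost_iff:
  fixes h :: "real \<Rightarrow> 'b::banach"
  shows "h integrable_on {..t} \<longleftrightarrow> (\<lambda>r. h (t - r)) integrable_on {0..}"
  by (simp only: integrable_on_def has_integral_atMost_iff)

lemma integral_atMost_eq:
  fixes h :: "real \<Rightarrow> 'b::banach"
  shows "integral {..t} h = integral {0..} (\<lambda>r. h (t - r))"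
  by (simp add: integral_def integrable_on_def has_integral_atMost_iff)

text \<open>The limit functions in the definition of almost automorphy are mere pointwise limits, and
  the integrals available for functions into a nonseparable Banach space come without a dominated
  convergence theorem. So \<open>v\<close> stands in for the integral of \<open>u\<close> without \<open>u\<close> being known to be
  integrable; two such values are compared through the real function
  \<open>\<lambda>r. norm (u r - u' r)\<close>, to which dominated convergence applies.\<close>

definition dominated_limit :: "(real \<Rightarrow> real) \<Rightarrow> (real \<Rightarrow> 'b::banach) \<Rightarrow> 'b \<Rightarrow> bool"
  where "dominated_limit h u v \<longleftrightarrow>
    (\<exists>w. (\<forall>n::nat. continuous_on {0..} (w n)) \<and> (\<forall>n. \<forall>r\<ge>0. norm (w n r) \<le> h r) \<and>
      (\<forall>r\<ge>0. (\<lambda>n. w n r) \<longlonglongrightarrow> u r) \<and> (\<lambda>n. integral {0..} (w n)) \<longlonglongrightarrow> v)"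

context
  fixes h :: "real \<Rightarrow> real"
  assumes h: "h integrable_on {0..}"
begin

private lemma double_h: "(\<lambda>r. 2 * h r) integrable_on {0..}"
  using h by (rule integrable_on_mult_right)

text \<open>For the continuous approximants this is the usual norm estimate of an integral; its
  right-hand side passes to the limit by real dominated convergence with majorant
  \<open>2 * h\<close>. The case \<open>u = u'\<close> shows that \<open>v\<close> is determined by
  \<open>u\<close>.\<close>

lemma dominated_limit_diff:
  assumes "dominated_limit h u v" "dominated_limit h u' v'"
  shows "(\<lambda>r. norm (u r - u' r)) integrable_on {0..}"
    and "norm (v - v') \<le> integral {0..} (\<lambda>r. norm (u r - u' r))"
    and "\<And>r. r \<ge> 0 \<Longrightarrow> norm (u r - u' r) \<le> 2 * h r"
proof -
  obtain w w' where w: "\<And>n::nat. continuous_on {0..} (w n)" "\<And>n r. r \<ge> 0 \<Longrightarrow> norm (w n r) \<le> h r"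
      "\<And>r. r \<ge> 0 \<Longrightarrow> (\<lambda>n. w n r) \<longlonglongrightarrow> u r" "(\<lambda>n. integral {0..} (w n)) \<longlonglongrightarrow> v"
    and w': "\<And>n::nat. continuous_on {0..} (w' n)" "\<And>n r. r \<ge> 0 \<Longrightarrow> norm (w' n r) \<le> h r"
      "\<And>r. r \<ge> 0 \<Longrightarrow> (\<lambda>n. w' n r) \<longlonglongrightarrow> u' r" "(\<lambda>n. integral {0..} (w' n)) \<longlonglongrightarrow> v'"
    using assms unfolding dominated_limit_def by metis
  have int: "w n integrable_on {0..}" "w' n integrable_on {0..}" for n
    using w w' h by (auto intro: integrable_on_atLeast_dominated)
  have le: "norm (w n r - w' n r) \<le> 2 * h r" if "r \<ge> 0" for n r
    using norm_triangle_ineq4[of "w n r" "w' n r"] w(2)[OF that, of n] w'(2)[OF that, of n] by simp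
  have dint: "(\<lambda>r. norm (w n r - w' n r)) integrable_on {0..}" for n
    by (rule integrable_on_atLeast_dominated[OF _ double_h]) (auto intro!: continuous_intros w w' simp: le)
  have lim: "(\<lambda>n. norm (w n r - w' n r)) \<longlonglongrightarrow> norm (u r - u' r)" if "r \<ge> 0" for r
    using that by (intro tendsto_intros w w')
  show "(\<lambda>r. norm (u r - u' r)) integrable_on {0..}"
    by (rule dominated_convergence(1)[where f = "\<lambda>n r. norm (w n r - w' n r)", OF dint double_h]) (auto simp: le lim)
  have "(\<lambda>n. integral {0..} (\<lambda>r. norm (w n r - w' n r))) \<longlonglongrightarrow> integral {0..} (\<lambda>r. norm (u r - u' r))"
    by (rule dominated_convergence(2)[OF dint double_h]) (auto simp: le lim)
  moreover have "norm (integral {0..} (w n) - integral {0..} (w' n))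
      \<le> integral {0..} (\<lambda>r. norm (w n r - w' n r))" for n
    using integral_norm_bound_integral[OF integrable_diff[OF int(1)[of n] int(2)[of n]] dint[of n]]
    by (simp add: integral_diff int)
  ultimately show "norm (v - v') \<le> integral {0..} (\<lambda>r. norm (u r - u' r))"
    by (intro LIMSEQ_le[OF tendsto_norm[OF tendsto_diff[OF w(4) w'(4)]]]) auto
  show "norm (u r - u' r) \<le> 2 * h r" if "r \<ge> 0" for r
    using LIMSEQ_le_const2[OF lim[OF that]] le[OF that] by blast
qed

text \<open>Only the real functions \<open>norm (u n r - z r)\<close> are integrated. They are
  bounded by \<open>2 * h\<close> and tend to zero pointwise, so their integrals vanish in the limit
  and carry \<open>v n - y\<close> with them.\<close>

lemma dominated_limit_tendsto:
  assumes u: "\<And>n. dominated_limit h (u n) (v n)" and z: "dominated_limit h z y"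
    and lim: "\<And>r. r \<ge> 0 \<Longrightarrow> (\<lambda>n. u n r) \<longlonglongrightarrow> z r"
  shows "v \<longlonglongrightarrow> y"
proof -
  have "(\<lambda>n. integral {0..} (\<lambda>r. norm (u n r - z r))) \<longlonglongrightarrow> integral {0..} (\<lambda>r::real. 0::real)"
    by (rule dominated_convergence(2)[where f = "\<lambda>n r. norm (u n r - z r)",
          OF dominated_limit_diff(1)[OF u z] double_h])
      (use dominated_limit_diff(3)[OF u z] tendsto_norm_zero[OF LIM_zero[OF lim]] in auto)
  then have *: "(\<lambda>n. integral {0..} (\<lambda>r. norm (u n r - z r))) \<longlonglongrightarrow> 0" by simp
  have "\<forall>\<^sub>F n in sequentially. norm (v n - y) \<le> integral {0..} (\<lambda>r. norm (u n r - z r))"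
    using dominated_limit_diff(2)[OF u z] by (intro always_eventually allI)
  then have "(\<lambda>n. v n - y) \<longlonglongrightarrow> 0"
    using * by (rule Lim_null_comparison)
  then show ?thesis by (rule LIM_zero_cancel)
qed

lemma dominated_limit_integral:
  assumes "continuous_on {0..} w" "\<And>r. r \<ge> 0 \<Longrightarrow> norm (w r) \<le> h r"
  shows "dominated_limit h w (integral {0..} w)"
  unfolding dominated_limit_def using assms by (intro exI[of _ "\<lambda>_. w"]) auto

text \<open>Completeness supplies \<open>v\<close>: the integrals of \<open>w n\<close> and
  \<open>w m\<close> differ by at most \<open>d n + d m\<close>, where \<open>d n\<close> is the
  integrated distance from \<open>w n\<close> to \<open>u\<close> and tends to zero.\<close>

lemma dominated_limit_exists:
  assumes w: "\<And>n::nat. continuous_on {0..} (w n)" "\<And>n r. r \<ge> 0 \<Longrightarrow> norm (w n r) \<le> h r"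
    and u: "\<And>r. r \<ge> 0 \<Longrightarrow> (\<lambda>n. w n r) \<longlonglongrightarrow> u r"
  obtains v where "dominated_limit h u v" "(\<lambda>n. integral {0..} (w n)) \<longlonglongrightarrow> v"
proof -
  have dw: "dominated_limit h (w n) (integral {0..} (w n))" for n
    by (intro dominated_limit_integral w)
  have lim: "(\<lambda>m. norm (w n r - w m r)) \<longlonglongrightarrow> norm (w n r - u r)" if "r \<ge> 0" for r n
    using that by (intro tendsto_intros u)
  have le: "norm (w n r - u r) \<le> 2 * h r" if "r \<ge> 0" for n r
    using LIMSEQ_le_const2[OF lim[OF that]] dominated_limit_diff(3)[OF dw dw] that by blast
  \<comment> \<open>With \<open>n\<close> fixed and \<open>m\<close> tending to infinity, the
    distance to \<open>u\<close> is a dominated limit of real functions, hence integrable although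
    \<open>u\<close> itself may not be.\<close>
  have int: "(\<lambda>r. norm (w n r - u r)) integrable_on {0..}" for n
    by (rule dominated_convergence(1)[where f = "\<lambda>m r. norm (w n r - w m r)",
          OF dominated_limit_diff(1)[OF dw dw] double_h])
      (auto simp: dominated_limit_diff(3)[OF dw dw] lim)
  define d where "d n = integral {0..} (\<lambda>r. norm (w n r - u r))" for n
  have "d \<longlonglongrightarrow> integral {0..} (\<lambda>r::real. 0::real)"
    unfolding d_def
    by (rule dominated_convergence(2)[where f = "\<lambda>n r. norm (w n r - u r)", OF int double_h])
      (use le tendsto_norm_zero[OF LIM_zero[OF u]] in auto)
  then have d: "d \<longlonglongrightarrow> 0" by simp
  have tri: "norm (w n r - w m r) \<le> norm (w n r - u r) + norm (w m r - u r)" for n m r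
    using dist_triangle2[of "w n r" "w m r" "u r"] by (simp only: dist_norm)
  have dd: "norm (integral {0..} (w n) - integral {0..} (w m)) \<le> d n + d m" for n m
  proof -
    have "norm (integral {0..} (w n) - integral {0..} (w m)) \<le> integral {0..} (\<lambda>r. norm (w n r - w m r))"
      by (rule dominated_limit_diff(2)[OF dw dw])
    also have "\<dots> \<le> integral {0..} (\<lambda>r. norm (w n r - u r) + norm (w m r - u r))"
      by (intro integral_le dominated_limit_diff(1)[OF dw dw] integrable_add int tri)
    finally show ?thesis by (simp add: d_def integral_add int)
  qed
  have "Cauchy (\<lambda>n. integral {0..} (w n))"
  proof (rule CauchyI)
    fix e :: real assume "e > 0"
    then obtain N where N: "\<And>n. n \<ge> N \<Longrightarrow> d n < e / 2"
      using order_tendstoD(2)[OF d, of "e / 2"] by (auto simp: eventually_sequentially)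
    show "\<exists>N. \<forall>m\<ge>N. \<forall>n\<ge>N. norm (integral {0..} (w m) - integral {0..} (w n)) < e"
    proof (intro exI[of _ N] allI impI)
      fix m n assume "m \<ge> N" "n \<ge> N"
      then show "norm (integral {0..} (w m) - integral {0..} (w n)) < e"
        using dd[of m n] N[of m] N[of n] by simp
    qed
  qed
  then obtain v where v: "(\<lambda>n. integral {0..} (w n)) \<longlonglongrightarrow> v"
    using Cauchy_convergent_iff convergent_def by blast
  have "dominated_limit h u v"
    unfolding dominated_limit_def using w u v by (intro exI[of _ w]) auto
  from this v show thesis by (rule that)
qed

lemma continuous_on_dominated_integral:
  fixes w :: "real \<Rightarrow> real \<Rightarrow> 'b::banach"
  assumes "\<And>t. continuous_on {0..} (w t)" "\<And>t r. r \<ge> 0 \<Longrightarrow> norm (w t r) \<le> h r"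
    and "\<And>r. r \<ge> 0 \<Longrightarrow> continuous_on UNIV (\<lambda>t. w t r)"
  shows "continuous_on UNIV (\<lambda>t. integral {0..} (w t))"
  unfolding continuous_on_sequentially o_def
proof (intro ballI allI impI, elim conjE)
  fix x :: "nat \<Rightarrow> real" and a assume x: "x \<longlonglongrightarrow> a"
  have dl: "dominated_limit h (w t) (integral {0..} (w t))" for t
    by (intro dominated_limit_integral assms)
  show "(\<lambda>n. integral {0..} (w (x n))) \<longlonglongrightarrow> integral {0..} (w a)"
    by (rule dominated_limit_tendsto[where u = "\<lambda>n. w (x n)", OF dl dl])
      (intro continuous_on_tendsto_compose[OF assms(3) x], auto)
qed

text \<open>In \<open>lim\<close> one subsequence must serve all \<open>t\<close> and
  \<open>r\<close> simultaneously. The limit \<open>wt t\<close> need not be integrable, so the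
  limit function of the integrals is built from the values \<open>v t\<close> of
  \<open>dominated_limit\<close>.\<close>

lemma almost_automorphic_dominated_integral:
  fixes w :: "real \<Rightarrow> real \<Rightarrow> 'b::banach"
  assumes w: "\<And>t. continuous_on {0..} (w t)" "\<And>t r. r \<ge> 0 \<Longrightarrow> norm (w t r) \<le> h r"
    and cont: "\<And>r. r \<ge> 0 \<Longrightarrow> continuous_on UNIV (\<lambda>t. w t r)"
    and lim: "\<And>\<sigma> :: nat \<Rightarrow> real. \<exists>\<kappa> wt. strict_mono \<kappa> \<and> (\<forall>t. \<forall>r\<ge>0.
      (\<lambda>n. w (t + \<sigma> (\<kappa> n)) r) \<longlonglongrightarrow> wt t r \<and> (\<lambda>n. wt (t - \<sigma> (\<kappa> n)) r) \<longlonglongrightarrow> w t r)"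
  shows "almost_automorphic (\<lambda>t. integral {0..} (w t))"
  unfolding almost_automorphic_def
proof (intro conjI allI)
  show "continuous_on UNIV (\<lambda>t. integral {0..} (w t))"
    by (intro continuous_on_dominated_integral w cont)
  have "w t integrable_on {0..}" for t
    by (intro integrable_on_atLeast_dominated[OF w(1) h] w(2))
  then have "norm (integral {0..} (w t)) \<le> integral {0..} h" for t
    using w(2) by (intro integral_norm_bound_integral h) auto
  then show "bounded (range (\<lambda>t. integral {0..} (w t)))"
    by (auto intro: boundedI)
  fix \<sigma> :: "nat \<Rightarrow> real"
  obtain \<kappa> wt where \<kappa>: "strict_mono \<kappa>"
    and wt: "\<And>t r. r \<ge> 0 \<Longrightarrow> (\<lambda>n. w (t + \<sigma> (\<kappa> n)) r) \<longlonglongrightarrow> wt t r"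
      "\<And>t r. r \<ge> 0 \<Longrightarrow> (\<lambda>n. wt (t - \<sigma> (\<kappa> n)) r) \<longlonglongrightarrow> w t r"
    using lim[of \<sigma>] by blast
  have "\<exists>v. dominated_limit h (wt t) v \<and> (\<lambda>n. integral {0..} (w (t + \<sigma> (\<kappa> n)))) \<longlonglongrightarrow> v" for t
    by (rule dominated_limit_exists[where w = "\<lambda>n. w (t + \<sigma> (\<kappa> n))"]) (use w wt(1) in blast)+
  then obtain v where v: "\<And>t. dominated_limit h (wt t) (v t)"
      "\<And>t. (\<lambda>n. integral {0..} (w (t + \<sigma> (\<kappa> n)))) \<longlonglongrightarrow> v t"
    by metis
  \<comment> \<open>On the way back the target \<open>w t\<close> is continuous, so its value under
    \<open>dominated_limit\<close> is its genuine integral.\<close>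
  have "(\<lambda>n. v (t - \<sigma> (\<kappa> n))) \<longlonglongrightarrow> integral {0..} (w t)" for t
    by (rule dominated_limit_tendsto[where u = "\<lambda>n. wt (t - \<sigma> (\<kappa> n))", OF v(1) dominated_limit_integral])
      (intro w wt(2); assumption)+
  with \<kappa> v(2) show "\<exists>\<kappa> ft. strict_mono \<kappa> \<and> (\<forall>t. (\<lambda>n. integral {0..} (w (t + \<sigma> (\<kappa> n)))) \<longlonglongrightarrow> ft t \<and>
      (\<lambda>n. ft (t - \<sigma> (\<kappa> n))) \<longlonglongrightarrow> integral {0..} (w t))"
    by blast
qed

end

subsection \<open>Almost automorphic functions\<close>

lemma almost_automorphicD:
  fixes \<sigma> :: "nat \<Rightarrow> real"
  assumes "almost_automorphic f"
  shows "continuous_on UNIV f" "bounded (range f)"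
    and "\<exists>\<kappa> ft. strict_mono \<kappa> \<and> (\<forall>t. (\<lambda>n. f (t + \<sigma> (\<kappa> n))) \<longlonglongrightarrow> ft t \<and> (\<lambda>n. ft (t - \<sigma> (\<kappa> n))) \<longlonglongrightarrow> f t)"
  using assms unfolding almost_automorphic_def by blast+

lemma almost_automorphic2D:
  fixes \<sigma> :: "nat \<Rightarrow> real"
  assumes "almost_automorphic2 f"
  shows "continuous_on UNIV (\<lambda>(t, x). f t x)" "bounded (range (\<lambda>(t, x). f t x))"
    and "bounded B \<Longrightarrow> \<exists>\<kappa> ft. strict_mono \<kappa> \<and>
      (\<forall>t. uniform_limit B (\<lambda>n x. f (t + \<sigma> (\<kappa> n)) x) (ft t) sequentially \<and>
        uniform_limit B (\<lambda>n x. ft (t - \<sigma> (\<kappa> n)) x) (f t) sequentially)"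
  using assms unfolding almost_automorphic2_def by blast+

lemma almost_automorphic_const: "almost_automorphic (\<lambda>_. c)"
  unfolding almost_automorphic_def
  by (auto intro!: exI[of _ id] exI[of _ "\<lambda>_. c"] strict_mono_id)

lemma almost_automorphic_shift:
  assumes "almost_automorphic f"
  shows "almost_automorphic (\<lambda>t. f (t - \<tau>))"
  unfolding almost_automorphic_def
proof (intro conjI allI)
  note f = almost_automorphicD[OF assms]
  show "continuous_on UNIV (\<lambda>t. f (t - \<tau>))"
    by (intro continuous_on_compose2[OF f(1)] continuous_intros) auto
  show "bounded (range (\<lambda>t. f (t - \<tau>)))"
    by (rule bounded_subset[OF f(2)]) auto
  fix \<sigma> :: "nat \<Rightarrow> real"
  obtain \<kappa> ft where \<kappa>: "strict_mono \<kappa>"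
    and ft: "\<And>t. (\<lambda>n. f (t + \<sigma> (\<kappa> n))) \<longlonglongrightarrow> ft t" "\<And>t. (\<lambda>n. ft (t - \<sigma> (\<kappa> n))) \<longlonglongrightarrow> f t"
    using f(3)[of \<sigma>] by blast
  have "(\<lambda>n. f (t + \<sigma> (\<kappa> n) - \<tau>)) \<longlonglongrightarrow> ft (t - \<tau>)" "(\<lambda>n. ft (t - \<sigma> (\<kappa> n) - \<tau>)) \<longlonglongrightarrow> f (t - \<tau>)" for t
    using ft[of "t - \<tau>"] by (simp_all add: algebra_simps)
  with \<kappa> show "\<exists>\<kappa> ft. strict_mono \<kappa> \<and> (\<forall>t. (\<lambda>n. f (t + \<sigma> (\<kappa> n) - \<tau>)) \<longlonglongrightarrow> ft t \<and>
      (\<lambda>n. ft (t - \<sigma> (\<kappa> n))) \<longlonglongrightarrow> f (t - \<tau>))"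
    by (intro exI[of _ \<kappa>] exI[of _ "\<lambda>t. ft (t - \<tau>)"]) simp
qed

text \<open>A diagonal subsequence serves all \<open>f k\<close> at once. Their limit functions
  \<open>ft k\<close> are again uniformly Cauchy, since bounds on distances survive pointwise
  limits; uniformity in \<open>k\<close> then permits interchanging the limits in both
  directions.\<close>

lemma almost_automorphic_uniform_limit:
  fixes f :: "nat \<Rightarrow> real \<Rightarrow> 'a::banach"
  assumes f: "\<And>k. almost_automorphic (f k)" and lim: "uniform_limit UNIV f g sequentially"
  shows "almost_automorphic g"
  unfolding almost_automorphic_def
proof (intro conjI allI)
  note fD = almost_automorphicD[OF f]
  show "continuous_on UNIV g"
    by (rule uniform_limit_theorem[OF _ lim]) (simp_all add: fD(1))
  obtain k where k: "\<And>t. dist (f k t) (g t) < 1"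
    using eventually_happens[OF uniform_limitD[OF lim zero_less_one]] by auto
  obtain C where C: "\<And>t. norm (f k t) \<le> C"
    using fD(2)[of k] unfolding bounded_iff by auto
  have "norm (g t) \<le> C + 1" for t
    using C[of t] k[of t] norm_triangle_sub[of "g t" "f k t"] by (simp add: dist_norm norm_minus_commute)
  then show "bounded (range g)" by (auto intro: boundedI)
  fix \<sigma> :: "nat \<Rightarrow> real"
  \<comment> \<open>The limit function is quantified inside \<open>P\<close>, so \<open>P k\<close>
    is a property of the index sequence alone; it persists under passage to subsequences, as the
    diagonal construction requires.\<close>
  define P where "P k s \<longleftrightarrow> (\<exists>ft. \<forall>t. (\<lambda>n. f k (t + \<sigma> (s n))) \<longlonglongrightarrow> ft t \<and> (\<lambda>n. ft (t - \<sigma> (s n))) \<longlonglongrightarrow> f k t)"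
    for k and s :: "nat \<Rightarrow> nat"
  interpret subseqs P
  proof
    fix k and s :: "nat \<Rightarrow> nat"
    show "\<exists>r'. strict_mono r' \<and> P k (s \<circ> r')"
      using fD(3)[of k "\<lambda>n. \<sigma> (s n)"] unfolding P_def o_def by blast
  qed
  have "P k (s \<circ> r)" if "strict_mono r" and Ps: "P k s" for r s k
  proof -
    obtain ft where "\<And>t. (\<lambda>n. f k (t + \<sigma> (s n))) \<longlonglongrightarrow> ft t" "\<And>t. (\<lambda>n. ft (t - \<sigma> (s n))) \<longlonglongrightarrow> f k t"
      using Ps unfolding P_def by blast
    from LIMSEQ_subseq_LIMSEQ[OF this(1) \<open>strict_mono r\<close>] LIMSEQ_subseq_LIMSEQ[OF this(2) \<open>strict_mono r\<close>]
    show ?thesis unfolding P_def o_def by blast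
  qed
  note diag = diagseq_holds[OF this]
  have "\<exists>ft. \<forall>t. (\<lambda>n. f k (t + \<sigma> (diagseq n))) \<longlonglongrightarrow> ft t \<and> (\<lambda>n. ft (t - \<sigma> (diagseq n))) \<longlonglongrightarrow> f k t" for k
  proof -
    \<comment> \<open>The diagonal sequence is a subsequence of the one selected for
      \<open>f k\<close> only from index \<open>Suc k\<close> on; dropping finitely many terms does
      not affect the limits.\<close>
    obtain ft where ft: "\<And>t. (\<lambda>n. f k (t + \<sigma> (diagseq (Suc k + n)))) \<longlonglongrightarrow> ft t"
        "\<And>t. (\<lambda>n. ft (t - \<sigma> (diagseq (Suc k + n)))) \<longlonglongrightarrow> f k t"
      using diag[of k] unfolding P_def o_def by blast
    have "(\<lambda>n. f k (t + \<sigma> (diagseq n))) \<longlonglongrightarrow> ft t" for t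
      by (rule LIMSEQ_offset[where k = "Suc k"]) (use ft(1)[of t] in \<open>simp only: add.commute\<close>)
    moreover have "(\<lambda>n. ft (t - \<sigma> (diagseq n))) \<longlonglongrightarrow> f k t" for t
      by (rule LIMSEQ_offset[where k = "Suc k"]) (use ft(2)[of t] in \<open>simp only: add.commute\<close>)
    ultimately show ?thesis by blast
  qed
  then obtain ft where ft: "\<And>k t. (\<lambda>n. f k (t + \<sigma> (diagseq n))) \<longlonglongrightarrow> ft k t"
      "\<And>k t. (\<lambda>n. ft k (t - \<sigma> (diagseq n))) \<longlonglongrightarrow> f k t"
    by metis
  have "uniformly_Cauchy_on UNIV ft"
  proof (rule uniformly_Cauchy_onI)
    fix e :: real assume "e > 0"
    then have "e / 2 > 0" by simp
    have "uniformly_Cauchy_on UNIV f"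
      using lim by (rule uniformly_convergent_Cauchy[OF uniformly_convergentI])
    with \<open>e / 2 > 0\<close> obtain N where N: "\<And>t m n. N \<le> m \<Longrightarrow> N \<le> n \<Longrightarrow> dist (f m t) (f n t) < e / 2"
      unfolding uniformly_Cauchy_on_def by blast
    \<comment> \<open>Strict inequality is lost in the limit, which is why the bound for
      \<open>f\<close> is taken with \<open>e / 2\<close>.\<close>
    have "dist (ft m t) (ft n t) \<le> e / 2" if "N \<le> m" "N \<le> n" for m n t
      by (rule LIMSEQ_le_const2[OF tendsto_dist[OF ft(1) ft(1)]]) (use N[OF that] in \<open>auto intro: less_imp_le\<close>)
    moreover have "e / 2 < e" using \<open>e > 0\<close> by simp
    ultimately have "dist (ft m t) (ft n t) < e" if "N \<le> m" "N \<le> n" for m n t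
      using that le_less_trans by blast
    then show "\<exists>N. \<forall>t\<in>UNIV. \<forall>m\<ge>N. \<forall>n\<ge>N. dist (ft m t) (ft n t) < e"
      by blast
  qed
  then obtain gt where gt: "uniform_limit UNIV ft gt sequentially"
    using Cauchy_uniformly_convergent unfolding uniformly_convergent_on_def by blast
  have "(\<lambda>n. g (t + \<sigma> (diagseq n))) \<longlonglongrightarrow> gt t" for t
  proof (rule swap_uniform_limit'[where S = UNIV and F = sequentially])
    show "uniform_limit UNIV (\<lambda>k n. f k (t + \<sigma> (diagseq n))) (\<lambda>n. g (t + \<sigma> (diagseq n))) sequentially"
      using lim by (auto simp: uniform_limit_iff elim!: eventually_mono)
    show "(\<lambda>k. ft k t) \<longlonglongrightarrow> gt t" by (rule tendsto_uniform_limitI[OF gt UNIV_I])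
  qed (simp_all add: ft)
  moreover have "(\<lambda>n. gt (t - \<sigma> (diagseq n))) \<longlonglongrightarrow> g t" for t
  proof (rule swap_uniform_limit'[where S = UNIV and F = sequentially])
    show "uniform_limit UNIV (\<lambda>k n. ft k (t - \<sigma> (diagseq n))) (\<lambda>n. gt (t - \<sigma> (diagseq n))) sequentially"
      using gt by (auto simp: uniform_limit_iff elim!: eventually_mono)
    show "(\<lambda>k. f k t) \<longlonglongrightarrow> g t" by (rule tendsto_uniform_limitI[OF lim UNIV_I])
  qed (simp_all add: ft)
  ultimately show "\<exists>\<kappa> ft. strict_mono \<kappa> \<and> (\<forall>t. (\<lambda>n. g (t + \<sigma> (\<kappa> n))) \<longlonglongrightarrow> ft t \<and> (\<lambda>n. ft (t - \<sigma> (\<kappa> n))) \<longlonglongrightarrow> g t)"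
    using subseq_diagseq by blast
qed

text \<open>A Lipschitz constant common to all \<open>F n\<close> makes replacing the moving
  argument \<open>u n\<close> by its limit \<open>y\<close> cost at most
  \<open>L * dist (u n) y\<close>.\<close>

lemma tendsto_equi_lipschitz:
  fixes F :: "'i \<Rightarrow> 'a::metric_space \<Rightarrow> 'b::metric_space"
  assumes F: "\<forall>\<^sub>F n in A. L-lipschitz_on UNIV (F n)" and l: "((\<lambda>n. F n y) \<longlongrightarrow> l) A"
    and u: "(u \<longlongrightarrow> y) A"
  shows "((\<lambda>n. F n (u n)) \<longlongrightarrow> l) A"
proof (rule metric_tendsto_imp_tendsto)
  show "((\<lambda>n. L * dist (u n) y + dist (F n y) l) \<longlongrightarrow> 0) A"
    using tendsto_add[OF tendsto_mult[OF tendsto_const[of L] tendsto_dist[OF u tendsto_const[of y]]]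
        tendsto_dist[OF l tendsto_const[of l]]] by simp
  show "\<forall>\<^sub>F n in A. dist (F n (u n)) l \<le> dist (L * dist (u n) y + dist (F n y) l) 0"
    using F
  proof eventually_elim
    case (elim n)
    have "dist (F n (u n)) (F n y) \<le> L * dist (u n) y"
      using elim by (rule lipschitz_onD) auto
    then show ?case
      using dist_triangle[of "F n (u n)" l "F n y"] by (simp add: dist_real_def)
  qed
qed

text \<open>Counterpart for maps \<open>F n\<close> without a known Lipschitz bound: uniform
  convergence on a set containing every \<open>u n\<close> replaces \<open>F n\<close> by
  \<open>G\<close> before the argument moves.\<close>

lemma tendsto_uniform_limit_compose:
  assumes F: "uniform_limit B F G A" and u: "\<And>n. u n \<in> B" and l: "((\<lambda>n. G (u n)) \<longlongrightarrow> l) A"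
  shows "((\<lambda>n. F n (u n)) \<longlongrightarrow> l) A"
proof (rule tendstoI)
  fix e :: real assume "e > 0"
  then have "e / 2 > 0" by simp
  from uniform_limitD[OF F this] tendstoD[OF l this]
  show "\<forall>\<^sub>F n in A. dist (F n (u n)) l < e"
  proof eventually_elim
    case (elim n)
    from elim(1) u have "dist (F n (u n)) (G (u n)) < e / 2" by blast
    with elim(2) show ?case using dist_triangle[of "F n (u n)" l "G (u n)"] by simp
  qed
qed

lemma almost_automorphic_compose:
  fixes f :: "real \<Rightarrow> 'a::real_normed_vector \<Rightarrow> 'b::real_normed_vector"
  assumes f: "almost_automorphic2 f" and lip: "\<And>t. L-lipschitz_on UNIV (f t)"
    and x: "almost_automorphic x"
  shows "almost_automorphic (\<lambda>t. f t (x t))"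
  unfolding almost_automorphic_def
proof (intro conjI allI)
  note xD = almost_automorphicD[OF x]
  note fD = almost_automorphic2D[OF f]
  show "continuous_on UNIV (\<lambda>t. f t (x t))"
    using continuous_on_compose2[OF fD(1) continuous_on_Pair[OF continuous_on_id xD(1)]] by simp
  show "bounded (range (\<lambda>t. f t (x t)))"
    by (rule bounded_subset[OF fD(2)]) auto
  fix \<sigma> :: "nat \<Rightarrow> real"
  \<comment> \<open>The limit function \<open>xt\<close> takes values only in the closure of the
    range, and \<open>ft\<close> is controlled only on the chosen bounded set.\<close>
  define B where "B = closure (range x)"
  have "bounded B" unfolding B_def by (rule bounded_closure[OF xD(2)])
  obtain \<kappa> xt where \<kappa>: "strict_mono \<kappa>"
    and xt: "\<And>t. (\<lambda>n. x (t + \<sigma> (\<kappa> n))) \<longlonglongrightarrow> xt t" "\<And>t. (\<lambda>n. xt (t - \<sigma> (\<kappa> n))) \<longlonglongrightarrow> x t"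
    using xD(3)[of \<sigma>] by blast
  have xt_B: "xt t \<in> B" for t
    unfolding B_def closure_sequential
    by (intro exI[of _ "\<lambda>n. x (t + \<sigma> (\<kappa> n))"] conjI allI rangeI xt(1))
  obtain \<mu> ft where \<mu>: "strict_mono \<mu>"
    and ft: "\<And>t. uniform_limit B (\<lambda>n y. f (t + \<sigma> (\<kappa> (\<mu> n))) y) (ft t) sequentially"
      "\<And>t. uniform_limit B (\<lambda>n y. ft (t - \<sigma> (\<kappa> (\<mu> n))) y) (f t) sequentially"
    using fD(3)[OF \<open>bounded B\<close>, of "\<lambda>n. \<sigma> (\<kappa> n)"] by blast
  have xt': "(\<lambda>n. x (t + \<sigma> (\<kappa> (\<mu> n)))) \<longlonglongrightarrow> xt t" "(\<lambda>n. xt (t - \<sigma> (\<kappa> (\<mu> n)))) \<longlonglongrightarrow> x t" for t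
    using LIMSEQ_subseq_LIMSEQ[OF xt(1) \<mu>] LIMSEQ_subseq_LIMSEQ[OF xt(2) \<mu>] by (simp_all add: o_def)
  have "(\<lambda>n. f (t + \<sigma> (\<kappa> (\<mu> n))) (x (t + \<sigma> (\<kappa> (\<mu> n))))) \<longlonglongrightarrow> ft t (xt t)" for t
    by (rule tendsto_equi_lipschitz[where L = L and F = "\<lambda>n. f (t + \<sigma> (\<kappa> (\<mu> n)))",
          OF _ tendsto_uniform_limitI[OF ft(1) xt_B] xt'(1)]) (simp add: lip)
  \<comment> \<open>Here \<open>ft\<close> meets a moving argument, so it is first exchanged for
    \<open>f t\<close> uniformly on \<open>B\<close>; the Lipschitz bound of \<open>f t\<close>
    finishes.\<close>
  moreover have "(\<lambda>n. ft (t - \<sigma> (\<kappa> (\<mu> n))) (xt (t - \<sigma> (\<kappa> (\<mu> n))))) \<longlonglongrightarrow> f t (x t)" for t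
    by (rule tendsto_uniform_limit_compose[where F = "\<lambda>n. ft (t - \<sigma> (\<kappa> (\<mu> n)))", OF ft(2) xt_B])
      (rule tendsto_equi_lipschitz[where L = L and F = "\<lambda>_. f t", OF _ tendsto_const xt'(2)], simp add: lip)
  ultimately show "\<exists>\<kappa> ft. strict_mono \<kappa> \<and> (\<forall>t. (\<lambda>n. f (t + \<sigma> (\<kappa> n)) (x (t + \<sigma> (\<kappa> n)))) \<longlonglongrightarrow> ft t \<and>
      (\<lambda>n. ft (t - \<sigma> (\<kappa> n))) \<longlonglongrightarrow> f t (x t))"
    using strict_mono_o[OF \<kappa> \<mu>]
    by (intro exI[of _ "\<kappa> \<circ> \<mu>"] exI[of _ "\<lambda>t. ft t (xt t)"]) (simp add: o_def)
qed

subsection \<open>Exponentially stable evolution families\<close>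

lemma bi_almost_automorphicD:
  fixes \<sigma> :: "nat \<Rightarrow> real"
  assumes "bi_almost_automorphic U" "bounded B"
  shows "\<exists>\<kappa> Ut. strict_mono \<kappa> \<and> (\<forall>t s. s \<le> t \<longrightarrow>
    uniform_limit B (\<lambda>n. U (t + \<sigma> (\<kappa> n)) (s + \<sigma> (\<kappa> n))) (Ut t s) sequentially \<and>
    uniform_limit B (\<lambda>n. Ut (t - \<sigma> (\<kappa> n)) (s - \<sigma> (\<kappa> n))) (U t s) sequentially)"
  using assms unfolding bi_almost_automorphic_def by blast

locale exp_stable_evolution =
  fixes U :: "real \<Rightarrow> real \<Rightarrow> 'a::banach \<Rightarrow>\<^sub>L 'a" and M \<delta> :: real
  assumes M_pos: "M > 0" and \<delta>_pos: "\<delta> > 0"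
    and norm_U_le: "\<And>t s. s \<le> t \<Longrightarrow> norm (U t s) \<le> M * exp (- \<delta> * (t - s))"
    and U_comp: "\<And>t s r. r \<le> s \<Longrightarrow> s \<le> t \<Longrightarrow> U t s o\<^sub>L U s r = U t r"
    and U_cont: "\<And>x. continuous_on {(t, s). s \<le> t} (\<lambda>(t, s). U t s x)"
begin

text \<open>For bounded continuous \<open>g\<close> this is the only bounded function satisfying the
  variation of constants formula with forcing \<open>g\<close>.\<close>

definition convolution :: "(real \<Rightarrow> 'a) \<Rightarrow> real \<Rightarrow> 'a"
  where "convolution g t = integral {..t} (\<lambda>s. U t s (g s))"

lemma norm_U_le_M: "s \<le> t \<Longrightarrow> norm (U t s) \<le> M"
proof -
  assume "s \<le> t"
  then have "exp (- \<delta> * (t - s)) \<le> 1" using \<delta>_pos by (simp add: mult_nonneg_nonneg)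
  with norm_U_le[OF \<open>s \<le> t\<close>] M_pos show ?thesis
    using mult_left_le[of "exp (- \<delta> * (t - s))" M] by linarith
qed

lemma lipschitz_U: "s \<le> t \<Longrightarrow> M-lipschitz_on UNIV (blinfun_apply (U t s))"
proof (rule lipschitz_onI)
  fix x y assume "s \<le> t"
  have "dist (U t s x) (U t s y) = norm (U t s (x - y))"
    by (simp add: dist_norm blinfun.diff_right)
  also have "\<dots> \<le> norm (U t s) * norm (x - y)" by (rule norm_blinfun)
  also have "\<dots> \<le> M * norm (x - y)"
    by (intro mult_right_mono norm_U_le_M \<open>s \<le> t\<close>) simp
  finally show "dist (U t s x) (U t s y) \<le> M * dist x y" by (simp add: dist_norm)
qed (use M_pos in simp)

text \<open>Strong continuity concerns a fixed vector; the Lipschitz constant \<open>M\<close>,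
  common to all times, extends it to a vector that moves as well.\<close>

lemma continuous_on_U:
  fixes a b :: "'i::topological_space \<Rightarrow> real"
  assumes a: "continuous_on S a" and b: "continuous_on S b" and z: "continuous_on S z"
    and le: "\<And>x. x \<in> S \<Longrightarrow> b x \<le> a x"
  shows "continuous_on S (\<lambda>x. U (a x) (b x) (z x))"
  unfolding continuous_on_def
proof
  fix x assume x: "x \<in> S"
  have "continuous_on S (\<lambda>y. U (a y) (b y) (z x))"
    using continuous_on_compose2[OF U_cont[of "z x"] continuous_on_Pair[OF a b]] le by auto
  then have lim: "((\<lambda>y. U (a y) (b y) (z x)) \<longlongrightarrow> U (a x) (b x) (z x)) (at x within S)"
    using x by (simp add: continuous_on_def)
  have "\<forall>\<^sub>F y in at x within S. M-lipschitz_on UNIV (blinfun_apply (U (a y) (b y)))"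
    by (auto simp: eventually_at_filter lipschitz_U le)
  from tendsto_equi_lipschitz[where F = "\<lambda>y. blinfun_apply (U (a y) (b y))", OF this lim]
  show "((\<lambda>y. U (a y) (b y) (z y)) \<longlongrightarrow> U (a x) (b x) (z x)) (at x within S)"
    using z x by (simp add: continuous_on_def)
qed

lemma norm_U_apply_le:
  assumes "norm x \<le> C" "s \<le> t"
  shows "norm (U t s x) \<le> M * C * exp (- \<delta> * (t - s))"
proof -
  have "norm (U t s x) \<le> norm (U t s) * norm x" by (rule norm_blinfun)
  also have "\<dots> \<le> (M * exp (- \<delta> * (t - s))) * C"
    using assms M_pos by (intro mult_mono norm_U_le) auto
  finally show ?thesis by (simp add: mult_ac)
qed

lemma has_integral_exp_decay: "((\<lambda>r. K * exp (- \<delta> * r)) has_integral K / \<delta>) {0..}"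
  using has_integral_mult_right[OF has_integral_exp_minus_to_infinity[OF \<delta>_pos, of 0], of K] by simp

section \<open>Bounded solutions of the inhomogeneous linear equation\<close>

context
  fixes g :: "real \<Rightarrow> 'a" and C :: real
  assumes g_cont: "continuous_on UNIV g" and g_le: "\<And>s. norm (g s) \<le> C"
begin

lemma convolution_eq: "convolution g t = integral {0..} (\<lambda>r. U t (t - r) (g (t - r)))"
  unfolding convolution_def by (rule integral_atMost_eq)

lemma continuous_on_convolution_integrand:
  "continuous_on {0..} (\<lambda>r. U t (t - r) (g (t - r)))"
  by (intro continuous_on_U continuous_on_compose2[OF g_cont] continuous_intros) auto

lemma norm_convolution_integrand_le:
  "r \<ge> 0 \<Longrightarrow> norm (U t (t - r) (g (t - r))) \<le> M * C * exp (- \<delta> * r)"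
  using norm_U_apply_le[OF g_le[of "t - r"], of "t - r" t] by simp

lemma convolution_integrable: "(\<lambda>s. U t s (g s)) integrable_on {..t}"
proof -
  have "(\<lambda>r. U t (t - r) (g (t - r))) integrable_on {0..}"
    by (rule integrable_on_atLeast_dominated[OF continuous_on_convolution_integrand
        has_integral_integrable[OF has_integral_exp_decay[of "M * C"]] norm_convolution_integrand_le])
  then show ?thesis by (simp only: integrable_on_atMost_iff)
qed

text \<open>The bound is the total mass of the exponential majorant. Applied to a difference of
  forcings bounded by \<open>L * d\<close>, it produces the contraction constant
  \<open>M * L / \<delta>\<close>.\<close>

lemma norm_convolution_le: "norm (convolution g t) \<le> M * C / \<delta>"
proof -
  have "(\<lambda>r. U t (t - r) (g (t - r))) integrable_on {0..}"
    using convolution_integrable[of t] by (simp only: integrable_on_atMost_iff)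
  then have "norm (convolution g t) \<le> integral {0..} (\<lambda>r. M * C * exp (- \<delta> * r))"
    unfolding convolution_eq
    by (rule integral_norm_bound_integral[OF _ has_integral_integrable[OF has_integral_exp_decay]])
      (rule norm_convolution_integrand_le, simp)
  then show ?thesis by (simp only: integral_unique[OF has_integral_exp_decay])
qed

text \<open>Splitting \<open>{..t}\<close> at \<open>a\<close>, the factorisation of
  \<open>U t s\<close> through time \<open>a\<close> lets the bounded operator \<open>U t a\<close>
  be pulled out of the integral over the past; the overlap \<open>{a}\<close> is negligible.\<close>

lemma convolution_mild:
  assumes "a \<le> t"
  shows "convolution g t = U t a (convolution g a) + integral {a..t} (\<lambda>s. U t s (g s))"
proof -
  have "((\<lambda>s. U a s (g s)) has_integral convolution g a) {..a}"
    unfolding convolution_def by (rule integrable_integral[OF convolution_integrable])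
  from has_integral_linear[OF this blinfun.bounded_linear_right[of "U t a"]]
  have "((\<lambda>s. U t a (U a s (g s))) has_integral U t a (convolution g a)) {..a}"
    by (simp add: o_def)
  moreover have "U t a (U a s (g s)) = U t s (g s)" if "s \<in> {..a}" for s
    using U_comp[of s a t] assms that by (simp flip: blinfun_apply_blinfun_compose)
  ultimately have 1: "((\<lambda>s. U t s (g s)) has_integral U t a (convolution g a)) {..a}"
    by (rule has_integral_eq[rotated])
  have "continuous_on {a..t} (\<lambda>s. U t s (g s))"
    by (intro continuous_on_U continuous_on_subset[OF g_cont] continuous_intros) auto
  then have 2: "((\<lambda>s. U t s (g s)) has_integral integral {a..t} (\<lambda>s. U t s (g s))) {a..t}"
    by (intro integrable_integral integrable_continuous_real)
  have "{..a} \<inter> {a..t} = {a}" "{..a} \<union> {a..t} = {..t}" using assms by auto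
  with has_integral_Un[OF 1 2]
  have "((\<lambda>s. U t s (g s)) has_integral U t a (convolution g a) + integral {a..t} (\<lambda>s. U t s (g s))) {..t}"
    by simp
  from integral_unique[OF this] show ?thesis
    by (simp only: convolution_def[of g t])
qed

text \<open>The difference of two bounded solutions is transported by \<open>U\<close>, so stability lets it vanish
  when the initial time tends to \<open>-\<infinity>\<close>.\<close>

lemma bounded_mild_eq_convolution:
  assumes bd: "bounded (range x)"
    and x: "\<And>a t. a \<le> t \<Longrightarrow> x t = U t a (x a) + integral {a..t} (\<lambda>s. U t s (g s))"
  shows "x t = convolution g t"
proof -
  obtain X where X: "\<And>s. norm (x s) \<le> X" using bd unfolding bounded_iff by auto
  \<comment> \<open>The sum \<open>X + M * C / \<delta>\<close> bounds the difference of the two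
    solutions at every initial time \<open>t - r\<close>, and transport by \<open>U\<close>
    contributes the factor \<open>M\<close>.\<close>
  define K where "K = M * (X + M * C / \<delta>)"
  have le: "norm (x t - convolution g t) \<le> K * exp (- \<delta> * r)" if "r \<ge> 0" for r
  proof -
    have "x t - convolution g t = U t (t - r) (x (t - r) - convolution g (t - r))"
      using x[of "t - r" t] convolution_mild[of "t - r" t] that by (simp add: blinfun.diff_right)
    moreover have "norm (x (t - r) - convolution g (t - r)) \<le> X + M * C / \<delta>"
      using norm_triangle_ineq4 add_mono[OF X norm_convolution_le] by (rule order_trans)
    ultimately show ?thesis
      using norm_U_apply_le[of "x (t - r) - convolution g (t - r)" "X + M * C / \<delta>" "t - r" t] that
      by (simp add: K_def)
  qed
  have "filterlim (\<lambda>r. - \<delta> * r) at_bot at_top"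
    by (rule filterlim_tendsto_neg_mult_at_bot[OF tendsto_const _ filterlim_ident]) (simp add: \<delta>_pos)
  then have "((\<lambda>r. exp (- \<delta> * r)) \<longlongrightarrow> 0) at_top"
    by (rule filterlim_compose[OF exp_at_bot])
  from tendsto_mult[OF tendsto_const this]
  have "norm (x t - convolution g t) \<le> K * 0"
    by (rule tendsto_lowerbound) (rule eventually_mono[OF eventually_ge_at_top[of 0] le], simp_all)
  then show ?thesis by simp
qed

end

lemma convolution_diff:
  assumes "continuous_on UNIV g" "\<And>s. norm (g s) \<le> C" "continuous_on UNIV g'" "\<And>s. norm (g' s) \<le> C'"
  shows "convolution g t - convolution g' t = convolution (\<lambda>s. g s - g' s) t"
  unfolding convolution_def blinfun.diff_right
  by (rule integral_diff[symmetric]; rule convolution_integrable[OF assms(1,2)] convolution_integrable[OF assms(3,4)])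

text \<open>For fixed \<open>r\<close> a time translation shifts \<open>t\<close> and
  \<open>t - r\<close> alike, so the integrand converges by bi-almost automorphy, along a
  subsequence independent of \<open>t\<close> and \<open>r\<close>; the exponential majorant carries
  this over to the integral.\<close>

lemma almost_automorphic_convolution:
  assumes bi: "bi_almost_automorphic (\<lambda>t s. blinfun_apply (U t s))" and g: "almost_automorphic g"
  shows "almost_automorphic (convolution g)"
proof -
  note gD = almost_automorphicD[OF g]
  obtain C where C: "\<And>s. norm (g s) \<le> C" using gD(2) unfolding bounded_iff by auto
  have "almost_automorphic (\<lambda>t. integral {0..} (\<lambda>r. U t (t - r) (g (t - r))))"
  proof (rule almost_automorphic_dominated_integral[where h = "\<lambda>r. M * C * exp (- \<delta> * r)",
        OF has_integral_integrable[OF has_integral_exp_decay[of "M * C"]]])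
    show "continuous_on {0..} (\<lambda>r. U t (t - r) (g (t - r)))" for t
      by (rule continuous_on_convolution_integrand[OF gD(1) C])
    show "norm (U t (t - r) (g (t - r))) \<le> M * C * exp (- \<delta> * r)" if "r \<ge> 0" for t r
      by (rule norm_convolution_integrand_le[OF gD(1) C that])
    show "continuous_on UNIV (\<lambda>t. U t (t - r) (g (t - r)))" if "r \<ge> 0" for r
      using that by (intro continuous_on_U continuous_on_compose2[OF gD(1)] continuous_intros) auto
    fix \<sigma> :: "nat \<Rightarrow> real"
    define B where "B = closure (range g)"
    have "bounded B" unfolding B_def by (rule bounded_closure[OF gD(2)])
    obtain \<kappa> gt where \<kappa>: "strict_mono \<kappa>"
      and gt: "\<And>t. (\<lambda>n. g (t + \<sigma> (\<kappa> n))) \<longlonglongrightarrow> gt t" "\<And>t. (\<lambda>n. gt (t - \<sigma> (\<kappa> n))) \<longlonglongrightarrow> g t"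
      using gD(3)[of \<sigma>] by blast
    have gt_B: "gt t \<in> B" for t
      unfolding B_def closure_sequential
      by (intro exI[of _ "\<lambda>n. g (t + \<sigma> (\<kappa> n))"] conjI allI rangeI gt(1))
    obtain \<mu> Ut where \<mu>: "strict_mono \<mu>"
      and Ut: "\<And>t s. s \<le> t \<Longrightarrow>
          uniform_limit B (\<lambda>n. U (t + \<sigma> (\<kappa> (\<mu> n))) (s + \<sigma> (\<kappa> (\<mu> n)))) (Ut t s) sequentially"
        "\<And>t s. s \<le> t \<Longrightarrow>
          uniform_limit B (\<lambda>n. Ut (t - \<sigma> (\<kappa> (\<mu> n))) (s - \<sigma> (\<kappa> (\<mu> n)))) (U t s) sequentially"
      using bi_almost_automorphicD[OF bi \<open>bounded B\<close>, of "\<lambda>n. \<sigma> (\<kappa> n)"] by blast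
    have gt': "(\<lambda>n. g (t + \<sigma> (\<kappa> (\<mu> n)))) \<longlonglongrightarrow> gt t" "(\<lambda>n. gt (t - \<sigma> (\<kappa> (\<mu> n)))) \<longlonglongrightarrow> g t" for t
      using LIMSEQ_subseq_LIMSEQ[OF gt(1) \<mu>] LIMSEQ_subseq_LIMSEQ[OF gt(2) \<mu>] by (simp_all add: o_def)
    have 1: "(\<lambda>n. U (t + \<sigma> (\<kappa> (\<mu> n))) (s + \<sigma> (\<kappa> (\<mu> n))) (g (s + \<sigma> (\<kappa> (\<mu> n))))) \<longlonglongrightarrow> Ut t s (gt s)"
      if "s \<le> t" for t s
      by (rule tendsto_equi_lipschitz[where L = M and
            F = "\<lambda>n. blinfun_apply (U (t + \<sigma> (\<kappa> (\<mu> n))) (s + \<sigma> (\<kappa> (\<mu> n))))",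
            OF _ tendsto_uniform_limitI[OF Ut(1)[OF that] gt_B] gt'(1)]) (simp add: lipschitz_U that)
    \<comment> \<open>\<open>Ut\<close> is controlled only on \<open>B\<close>, which contains all
      values of \<open>gt\<close>; it is exchanged for \<open>U t s\<close> there before the
      argument converges.\<close>
    have 2: "(\<lambda>n. Ut (t - \<sigma> (\<kappa> (\<mu> n))) (s - \<sigma> (\<kappa> (\<mu> n))) (gt (s - \<sigma> (\<kappa> (\<mu> n))))) \<longlonglongrightarrow> U t s (g s)"
      if "s \<le> t" for t s
      by (rule tendsto_uniform_limit_compose[where F = "\<lambda>n. Ut (t - \<sigma> (\<kappa> (\<mu> n))) (s - \<sigma> (\<kappa> (\<mu> n)))",
            OF Ut(2)[OF that] gt_B])
        (rule tendsto_equi_lipschitz[where L = M and F = "\<lambda>_. blinfun_apply (U t s)",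
            OF _ tendsto_const gt'(2)], simp add: lipschitz_U that)
    have "(\<lambda>n. U (t + \<sigma> (\<kappa> (\<mu> n))) (t + \<sigma> (\<kappa> (\<mu> n)) - r) (g (t + \<sigma> (\<kappa> (\<mu> n)) - r))) \<longlonglongrightarrow> Ut t (t - r) (gt (t - r))"
      if "r \<ge> 0" for t r
      using 1[of "t - r" t] that by (simp add: algebra_simps)
    moreover have "(\<lambda>n. Ut (t - \<sigma> (\<kappa> (\<mu> n))) (t - \<sigma> (\<kappa> (\<mu> n)) - r) (gt (t - \<sigma> (\<kappa> (\<mu> n)) - r))) \<longlonglongrightarrow> U t (t - r) (g (t - r))"
      if "r \<ge> 0" for t r
      using 2[of "t - r" t] that by (simp add: algebra_simps)
    ultimately show "\<exists>\<kappa> wt. strict_mono \<kappa> \<and> (\<forall>t. \<forall>r\<ge>0.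
        (\<lambda>n. U (t + \<sigma> (\<kappa> n)) (t + \<sigma> (\<kappa> n) - r) (g (t + \<sigma> (\<kappa> n) - r))) \<longlonglongrightarrow> wt t r \<and>
        (\<lambda>n. wt (t - \<sigma> (\<kappa> n)) r) \<longlonglongrightarrow> U t (t - r) (g (t - r)))"
      using strict_mono_o[OF \<kappa> \<mu>]
      by (intro exI[of _ "\<kappa> \<circ> \<mu>"] exI[of _ "\<lambda>t r. Ut t (t - r) (gt (t - r))"]) (simp add: o_def)
  qed
  moreover have "convolution g = (\<lambda>t. integral {0..} (\<lambda>r. U t (t - r) (g (t - r))))"
    by (rule ext) (rule convolution_eq[OF gD(1) C])
  ultimately show ?thesis by (simp only:)
qed

end

subsection \<open>The contraction argument\<close>

lemma sup_norm_le_iff: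
  assumes "bounded (range g)"
  shows "sup_norm g \<le> c \<longleftrightarrow> (\<forall>t. norm (g t) \<le> c)"
proof -
  have "bdd_above (range (\<lambda>t. norm (g t)))"
    using assms by (auto simp: bounded_iff bdd_above_def)
  then show ?thesis unfolding sup_norm_def by (simp add: cSUP_le_iff)
qed

lemma almost_automorphic_bcontfun:
  "almost_automorphic x \<Longrightarrow> apply_bcontfun (Bcontfun x) = x"
  by (simp add: Bcontfun_inverse bcontfun_def almost_automorphicD(1,2))

theorem theorem6p2:
  fixes D :: "real \<Rightarrow> 'a::complex_banach set"
    and A :: "real \<Rightarrow> 'a \<Rightarrow> 'a"
    and U :: "real \<Rightarrow> real \<Rightarrow> 'a \<Rightarrow>\<^sub>L 'a"
    and f :: "real \<Rightarrow> 'a \<Rightarrow> 'a"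
    and x0 :: "real \<Rightarrow> 'a"
    and \<tau> M \<delta> L \<rho> :: real
  assumes "\<tau> > 0"
    and "acquistapace_terreni D A"
    and "evolution_family U" and "governs D A U"
    and "bi_almost_automorphic (\<lambda>t s x. U t s x)"
    and "M > 0" and "\<delta> > 0"
    and "\<And>t s. s \<le> t \<Longrightarrow> norm (U t s) \<le> M * exp (- \<delta> * (t - s))"
    and "almost_automorphic2 f"
    and "\<And>t. L-lipschitz_on UNIV (f t)"
    and "\<rho> > 0"
    and "\<And>t. x0 t = integral {..t} (\<lambda>s. U t s (f s 0))"
    and "M / \<delta> * sup_norm (\<lambda>t. f t 0) \<le> \<rho>"
    and "M * L < \<rho> * \<delta> / (\<rho> + sup_norm x0)"
  shows "\<exists>!x. almost_automorphic x \<and> mild_solution U f \<tau> x \<and> sup_norm (\<lambda>t. x t - x0 t) \<le> \<rho>"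
proof -
  interpret exp_stable_evolution U M \<delta>
    using assms(3,6,7,8) by unfold_locales (auto simp: evolution_family_def)
  define G where "G x s = f s (x (s - \<tau>))" for x s
  have AA_G: "almost_automorphic (G x)" if "almost_automorphic x" for x
    unfolding G_def by (rule almost_automorphic_compose[OF assms(9,10) almost_automorphic_shift[OF that]])
  have AA_\<Gamma>: "almost_automorphic (convolution (G x))" if "almost_automorphic x" for x
    by (rule almost_automorphic_convolution[OF assms(5) AA_G[OF that]])
  obtain C where C: "\<And>s y. norm (f s y) \<le> C"
    using almost_automorphic2D(2)[OF assms(9)] unfolding bounded_iff by auto
  have G_le: "norm (G x s) \<le> C" for x s
    unfolding G_def by (rule C)
  note G_cont = almost_automorphicD(1)[OF AA_G]
  \<comment> \<open>Recognising \<open>x0\<close> as the image of the zero function lets the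
    contraction estimate measure distances from \<open>x0\<close> too.\<close>
  have x0: "x0 = convolution (G (\<lambda>_. 0))"
    by (rule ext) (simp add: assms(12) convolution_def G_def)
  have AA_x0: "almost_automorphic x0"
    unfolding x0 by (intro AA_\<Gamma> almost_automorphic_const)
  define c where "c = sup_norm x0"
  have c: "norm (x0 t) \<le> c" for t
    using sup_norm_le_iff[OF almost_automorphicD(2)[OF AA_x0], of c] by (simp add: c_def)
  have "c \<ge> 0" using c[of 0] norm_ge_zero order_trans by blast
  have "L \<ge> 0" using assms(10) by (rule lipschitz_on_nonneg)
  \<comment> \<open>The factor \<open>L\<close> comes from \<open>f\<close>, and
    \<open>M / \<delta>\<close> is the mass of the kernel.\<close>
  define q where "q = M * L / \<delta>"
  have "q \<ge> 0" using \<open>L \<ge> 0\<close> assms(6,7) by (simp add: q_def)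
  have q: "q * (\<rho> + c) \<le> \<rho>"
  proof -
    have "M * L * (\<rho> + c) < \<rho> * \<delta>"
      using assms(14) assms(11) \<open>c \<ge> 0\<close> by (simp add: c_def[symmetric] pos_less_divide_eq)
    then show ?thesis using assms(7) by (simp add: q_def field_simps)
  qed
  have "q < 1"
  proof -
    have "M * L < \<rho> * \<delta> / (\<rho> + c)" using assms(14) by (simp add: c_def)
    also have "\<dots> \<le> \<delta>"
      using assms(11,7) \<open>c \<ge> 0\<close> by (simp add: pos_divide_le_eq algebra_simps)
    finally show ?thesis using assms(7) by (simp add: q_def)
  qed
  \<comment> \<open>Stated for arbitrary almost automorphic functions with a pointwise bound
    \<open>d\<close>, so that it also compares with the zero function, which may lie outside the
    ball.\<close>
  have contr: "norm (convolution (G x) t - convolution (G y) t) \<le> q * d"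
    if x: "almost_automorphic x" and y: "almost_automorphic y" and d: "\<And>s. norm (x s - y s) \<le> d" for x y d t
  proof -
    have "norm (G x s - G y s) \<le> L * d" for s
    proof -
      have "norm (G x s - G y s) \<le> L * norm (x (s - \<tau>) - y (s - \<tau>))"
        using lipschitz_onD[OF assms(10), of "x (s - \<tau>)" "y (s - \<tau>)" s] by (simp add: G_def dist_norm)
      also have "\<dots> \<le> L * d" by (rule mult_left_mono[OF d \<open>L \<ge> 0\<close>])
      finally show ?thesis .
    qed
    from norm_convolution_le[OF continuous_on_diff[OF G_cont[OF x] G_cont[OF y]] this]
    show ?thesis
      by (simp add: convolution_diff[OF G_cont[OF x] G_le G_cont[OF y] G_le] q_def mult_ac)
  qed
  have self_map: "norm (convolution (G x) t - x0 t) \<le> \<rho>"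
    if x: "almost_automorphic x" and d: "\<And>s. norm (x s - x0 s) \<le> \<rho>" for x t
  proof -
    have "norm (x s - 0) \<le> \<rho> + c" for s
      using norm_triangle_sub[of "x s" "x0 s"] d[of s] c[of s] by simp
    from contr[OF x almost_automorphic_const this, of t] q show ?thesis
      by (simp add: x0)
  qed
  have mild_iff: "mild_solution U f \<tau> x \<longleftrightarrow> convolution (G x) = x" if x: "almost_automorphic x" for x
  proof
    assume "mild_solution U f \<tau> x"
    then have "x t = U t a (x a) + integral {a..t} (\<lambda>s. U t s (G x s))" if "a \<le> t" for a t
      using that unfolding mild_solution_def G_def by blast
    from bounded_mild_eq_convolution[OF G_cont[OF x] G_le almost_automorphicD(2)[OF x] this]
    show "convolution (G x) = x" by auto
  next
    assume eq: "convolution (G x) = x"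
    have "x t = U t a (x a) + integral {a..t} (\<lambda>s. U t s (G x s))" if "a \<le> t" for a t
      using convolution_mild[OF G_cont[OF x] G_le that] by (simp only: eq)
    then show "mild_solution U f \<tau> x"
      using almost_automorphicD(1)[OF x] by (simp add: mild_solution_def G_def)
  qed
  have ball_iff: "sup_norm (\<lambda>t. x t - x0 t) \<le> \<rho> \<longleftrightarrow> (\<forall>t. norm (x t - x0 t) \<le> \<rho>)"
    if x: "almost_automorphic x" for x
    by (intro sup_norm_le_iff bounded_minus_comp almost_automorphicD(2) x AA_x0)
  \<comment> \<open>Placing the ball inside the complete space of bounded continuous functions
    reduces its completeness to closedness under uniform limits.\<close>
  define S :: "(real \<Rightarrow>\<^sub>C 'a) set"
    where "S = {b. almost_automorphic (apply_bcontfun b) \<and> (\<forall>t. norm (b t - x0 t) \<le> \<rho>)}"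
  \<comment> \<open>\<open>Bcontfun\<close> is meaningful only on bounded continuous functions; on
    \<open>S\<close> this is ensured by the almost automorphy of the convolution.\<close>
  define F where "F b = Bcontfun (convolution (G (apply_bcontfun b)))" for b :: "real \<Rightarrow>\<^sub>C 'a"
  have apply_F: "apply_bcontfun (F b) = convolution (G (apply_bcontfun b))" if "b \<in> S" for b
    using that by (simp add: F_def S_def almost_automorphic_bcontfun AA_\<Gamma>)
  have "closed S"
    unfolding closed_sequential_limits
  proof (intro allI impI, elim conjE)
    fix b l assume b: "\<forall>n. b n \<in> S" and "b \<longlonglongrightarrow> l"
    then have lim: "uniform_limit UNIV b l sequentially"
      by (intro tendsto_bcontfun_uniform_limit)
    have "almost_automorphic (apply_bcontfun l)"
      by (rule almost_automorphic_uniform_limit[OF _ lim]) (use b in \<open>simp add: S_def\<close>)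
    moreover have "norm (l t - x0 t) \<le> \<rho>" for t
      by (rule LIMSEQ_le_const2[OF tendsto_norm[OF tendsto_diff[OF tendsto_uniform_limitI[OF lim UNIV_I] tendsto_const]]])
        (use b in \<open>simp add: S_def\<close>)
    ultimately show "l \<in> S" by (simp add: S_def)
  qed
  then have "complete S" by (simp add: complete_eq_closed)
  have "Bcontfun x0 \<in> S"
    using AA_x0 assms(11) by (simp add: S_def almost_automorphic_bcontfun)
  have "\<exists>!b\<in>S. F b = b"
  proof (rule Banach_fix[OF \<open>complete S\<close> _ \<open>q \<ge> 0\<close> \<open>q < 1\<close>])
    show "S \<noteq> {}" using \<open>Bcontfun x0 \<in> S\<close> by blast
    show "F ` S \<subseteq> S"
      using self_map AA_\<Gamma> by (auto simp: S_def apply_F[unfolded S_def])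
    fix b b' assume b: "b \<in> S" "b' \<in> S"
    show "dist (F b) (F b') \<le> q * dist b b'"
    proof (rule dist_bound)
      fix t
      have "norm (b s - b' s) \<le> dist b b'" for s
        using dist_bounded[of b s b'] by (simp add: dist_norm)
      with b contr[of "apply_bcontfun b" "apply_bcontfun b'" "dist b b'" t]
      show "dist (F b t) (F b' t) \<le> q * dist b b'"
        by (simp add: apply_F dist_norm[of _ "_ :: 'a"] S_def)
    qed
  qed
  then obtain b where b: "b \<in> S" "F b = b" and uniq: "\<And>b'. b' \<in> S \<Longrightarrow> F b' = b' \<Longrightarrow> b' = b"
    by blast
  show ?thesis
  proof (rule ex1I[of _ "apply_bcontfun b"])
    have "almost_automorphic (apply_bcontfun b)" "\<forall>t. norm (b t - x0 t) \<le> \<rho>"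
      using b(1) by (simp_all add: S_def)
    moreover have "convolution (G (apply_bcontfun b)) = apply_bcontfun b"
      using apply_F[OF b(1)] b(2) by simp
    ultimately show "almost_automorphic (apply_bcontfun b) \<and> mild_solution U f \<tau> (apply_bcontfun b) \<and>
        sup_norm (\<lambda>t. b t - x0 t) \<le> \<rho>"
      by (simp add: mild_iff ball_iff)
  next
    fix x assume x: "almost_automorphic x \<and> mild_solution U f \<tau> x \<and> sup_norm (\<lambda>t. x t - x0 t) \<le> \<rho>"
    then have x': "apply_bcontfun (Bcontfun x) = x"
      by (intro almost_automorphic_bcontfun) blast
    have "Bcontfun x \<in> S"
      using x ball_iff[of x] by (simp add: S_def x')
    moreover have "F (Bcontfun x) = Bcontfun x"
      using x mild_iff[of x] by (simp add: F_def x')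
    ultimately have "Bcontfun x = b" by (rule uniq)
    then show "x = apply_bcontfun b" using x' by simp
  qed
qed

end
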